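(* There is a 3-connected non-complete planar graph which is not degree-truncated $7$-choosable.
   Context: Graphs are finite and simple. A list assignment of a graph $G$ is a mapping $L$ assigning to each vertex $v$ a set $L(v)$ of permissible colours. An $L$-colouring of $G$ is a mapping $\phi$ with $\phi(v)\in L(v)$ for every vertex $v$ and $\phi(u)\neq\phi(v)$ for every edge $uv$; $G$ is $L$-colourable if it has an $L$-colouring. For a positive integer $k$, $G$ is degree-truncated $k$-choosable if $G$ is $L$-colourable for every list assignment $L$ with $|L(v)|\ge \min\{k,d_G(v)\}$ for every vertex $v$, where $d_G(v)$ is the degree of $v$ in $G$. *)

theory Defs
  imports "HOL-Analysis.Analysis" "Graph_Theory.Graph_Theory"
begin

text \<open>
  A finite simple graph is a finite symmetric loop-free digraph without parallel arcs
  (\<^locale>\<open>pair_graph\<close>): the edge \<open>uv\<close> is the pair of arcs \<open>(u,v)\<close> and \<open>(v,u)\<close>, so the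
  degree of a vertex is its \<^const>\<open>out_degree\<close>.
\<close>

definition k_connected :: "nat \<Rightarrow> 'a pair_pre_digraph \<Rightarrow> bool" where
  "k_connected k G \<longleftrightarrow>
     card (pverts G) > k \<and>
     (\<forall>S \<subseteq> pverts G. card S < k \<longrightarrow>
        Digraph_Component.connected (induce_subgraph (with_proj G) (pverts G - S)))"

text \<open>
  Drawings in the plane: vertices are distinct points and edges are arcs that meet each other,
  and the vertices, only at common ends. The two orientations of an edge are drawn by the same
  arc, traversed in opposite directions.
\<close>

definition plane_drawing ::
    "'a pair_pre_digraph \<Rightarrow> ('a \<Rightarrow> complex) \<Rightarrow> ('a \<Rightarrow> 'a \<Rightarrow> real \<Rightarrow> complex) \<Rightarrow> bool" where
  "plane_drawing G p \<gamma> \<longleftrightarrow>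
     inj_on p (pverts G) \<and>
     (\<forall>(u, v) \<in> parcs G.
        arc (\<gamma> u v) \<and> pathstart (\<gamma> u v) = p u \<and> pathfinish (\<gamma> u v) = p v \<and>
        \<gamma> v u = reversepath (\<gamma> u v) \<and>
        path_image (\<gamma> u v) \<inter> p ` pverts G = {p u, p v}) \<and>
     (\<forall>(u, v) \<in> parcs G. \<forall>(x, y) \<in> parcs G. {u, v} \<noteq> {x, y} \<longrightarrow>
        path_image (\<gamma> u v) \<inter> path_image (\<gamma> x y) \<subseteq> p ` ({u, v} \<inter> {x, y}))"

definition planar :: "'a pair_pre_digraph \<Rightarrow> bool" where
  "planar G \<longleftrightarrow> (\<exists>p \<gamma>. plane_drawing G p \<gamma>)"

definition list_colouring :: "'a pair_pre_digraph \<Rightarrow> ('a \<Rightarrow> 'c set) \<Rightarrow> ('a \<Rightarrow> 'c) \<Rightarrow> bool" where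
  "list_colouring G L \<phi> \<longleftrightarrow>
     (\<forall>v \<in> pverts G. \<phi> v \<in> L v) \<and> (\<forall>(u, v) \<in> parcs G. \<phi> u \<noteq> \<phi> v)"

definition list_colourable :: "'a pair_pre_digraph \<Rightarrow> ('a \<Rightarrow> 'c set) \<Rightarrow> bool" where
  "list_colourable G L \<longleftrightarrow> (\<exists>\<phi>. list_colouring G L \<phi>)"

text \<open>
  Colours are natural numbers. This is no restriction for a finite graph: every list can be
  shrunk to a finite one of the required size, and then only finitely many colours occur.
  Infinite lists are allowed and count as large enough; as \<^const>\<open>card\<close> is \<open>0\<close> on
  infinite sets, the size condition is imposed on the finite lists.
\<close>

definition degree_truncated_choosable :: "nat \<Rightarrow> 'a pair_pre_digraph \<Rightarrow> bool" where
  "degree_truncated_choosable k G \<longleftrightarrow>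
     (\<forall>L :: 'a \<Rightarrow> nat set.
        (\<forall>v \<in> pverts G. finite (L v) \<longrightarrow> min k (out_degree (with_proj G) v) \<le> card (L v)) \<longrightarrow>
        list_colourable G L)"

end

(*
  The graph is a stacked triangulation: starting from a triangle, vertices are placed one after
  another into a bounded face and joined to its three corners. Drawing each new vertex at the
  centroid of its face gives a straight-line drawing, and 3-connectedness is preserved because
  a new vertex keeps a neighbour when two vertices are deleted.

  Two adjacent hubs u, v are joined to all vertices of a path. The 49 pairs of colours of the
  hubs, with lists of size 7, correspond to 49 disjoint blocks of six consecutive path vertices.
  In the block of the pair (a, b) the path vertices lose a and b and keep five common colours.
  Between consecutive path vertices x, x' a vertex y of degree 4 is stacked into u x x' and a
  vertex t of degree 3 into x x' y, with lists P + a and P where |P| = 3: if u has colour a, then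
  x and x' cannot both have colours in P. The same is done on the side of v with a set Q. Five
  suitable pairs P, Q leave no colouring of the six path vertices.
*)
theory Submission
  imports Defs
begin

section \<open>Plane geometry of a triangle cut up at its centroid\<close>

text \<open>This is twice the signed area of the triangle \<open>A B P\<close>, positive when
  \<open>P\<close> lies strictly to the left of the directed line from \<open>A\<close> to
  \<open>B\<close>.\<close>

definition orient :: "complex \<Rightarrow> complex \<Rightarrow> complex \<Rightarrow> real" where
  "orient A B P = (Re B - Re A) * (Im P - Im A) - (Im B - Im A) * (Re P - Re A)"

text \<open>The three values add up to \<open>orient A B C\<close>, so the set is empty unless the
  corners run counterclockwise; then it is the interior of the triangle.\<close>

definition open_triangle :: "complex \<Rightarrow> complex \<Rightarrow> complex \<Rightarrow> complex set" where
  "open_triangle A B C = {P. 0 < orient A B P \<and> 0 < orient B C P \<and> 0 < orient C A P}"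

definition centroid :: "complex \<Rightarrow> complex \<Rightarrow> complex \<Rightarrow> complex" where
  "centroid A B C = (A + B + C) / 3"

lemma orient_rotate: "orient B C A = orient A B C"
  by (simp add: orient_def algebra_simps)

lemma triangle_rotate: "open_triangle B C A = open_triangle A B C"
  by (auto simp: open_triangle_def)

lemma centroid_rotate: "centroid B C A = centroid A B C"
  by (simp add: centroid_def add_ac)

lemma orient_centroid:
  "orient A B (centroid A B C) = orient A B C / 3"
  "orient B C (centroid A B C) = orient A B C / 3"
  "orient C A (centroid A B C) = orient A B C / 3"
  by (simp_all add: orient_def centroid_def field_simps)

lemma centroid_in_open_triangle:
  assumes "0 < orient A B C"
  shows "centroid A B C \<in> open_triangle A B C"
  using assms by (simp add: open_triangle_def orient_centroid)

text \<open>With \<open>Z\<close> the centroid, \<open>orient B Z P = (orient B C P - orient A B P) / 3\<close>, and similarly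
  for \<open>orient Z A P\<close>: the three small triangles are cut out by comparing the barycentric
  coordinates \<open>orient A B P\<close>, \<open>orient B C P\<close>, \<open>orient C A P\<close> of \<open>P\<close>.\<close>
lemma small_triangle_iff:
  "P \<in> open_triangle A B (centroid A B C) \<longleftrightarrow>
     0 < orient A B P \<and> orient A B P < orient B C P \<and> orient A B P < orient C A P"
  "P \<in> open_triangle B C (centroid A B C) \<longleftrightarrow>
     0 < orient B C P \<and> orient B C P < orient C A P \<and> orient B C P < orient A B P"
  "P \<in> open_triangle C A (centroid A B C) \<longleftrightarrow>
     0 < orient C A P \<and> orient C A P < orient A B P \<and> orient C A P < orient B C P"
proof -
  have "P \<in> open_triangle U V (centroid U V W) \<longleftrightarrow>
     0 < orient U V P \<and> orient U V P < orient V W P \<and> orient U V P < orient W U P" for U V W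
  proof -
    have "orient V (centroid U V W) P = (orient V W P - orient U V P) / 3"
      "orient (centroid U V W) U P = (orient W U P - orient U V P) / 3"
      by (simp_all add: orient_def centroid_def field_simps)
    then show ?thesis
      by (auto simp: open_triangle_def)
  qed
  from this[of A B C] this[of B C A] this[of C A B]
  show "P \<in> open_triangle A B (centroid A B C) \<longleftrightarrow>
     0 < orient A B P \<and> orient A B P < orient B C P \<and> orient A B P < orient C A P"
  "P \<in> open_triangle B C (centroid A B C) \<longleftrightarrow>
     0 < orient B C P \<and> orient B C P < orient C A P \<and> orient B C P < orient A B P"
  "P \<in> open_triangle C A (centroid A B C) \<longleftrightarrow>
     0 < orient C A P \<and> orient C A P < orient A B P \<and> orient C A P < orient B C P"
    unfolding centroid_rotate[of A B C] centroid_rotate[of C A B, symmetric] by blast+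
qed

lemma orient_on_median:
  assumes "P = (1 - t) *\<^sub>R centroid A B C + t *\<^sub>R A"
  shows "orient A B P = (1 - t) * orient A B C / 3"
    and "orient C A P = (1 - t) * orient A B C / 3"
    and "orient B C P = (1 + 2 * t) * orient A B C / 3"
  by (simp_all add: assms orient_def centroid_def field_simps)

text \<open>From the centroid to \<open>A\<close>, the coordinates for the two sides at
  \<open>A\<close> stay equal and shrink to 0, while the third one grows. The centroid, where all
  three agree, and \<open>A\<close>, where two vanish, are separate cases.\<close>

lemma on_median:
  assumes "0 < orient A B C" "P \<in> closed_segment (centroid A B C) A"
  shows "P = centroid A B C \<or>
    orient A B P = orient C A P \<and> orient A B P < orient B C P \<and> (P = A \<or> P \<in> open_triangle A B C)"
proof -
  obtain t where t: "0 \<le> t" "t \<le> 1" "P = (1 - t) *\<^sub>R centroid A B C + t *\<^sub>R A"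
    using assms(2) by (auto simp: in_segment)
  show ?thesis
  proof (cases "t = 0")
    case True
    then show ?thesis using t by simp
  next
    case False
    then have "0 < t * orient A B C"
      using t assms by simp
    moreover have "0 < (1 - t) * orient A B C" if "t \<noteq> 1"
      using that t assms by simp
    moreover have "P = A" if "t = 1"
      using that t by simp
    ultimately show ?thesis
      using orient_on_median[OF t(3)]
      by (cases "t = 1") (auto simp: open_triangle_def algebra_simps)
  qed
qed

lemma median_subset:
  assumes "0 < orient A B C" "W \<in> {A, B, C}" "P \<in> closed_segment (centroid A B C) W"
  shows "P = W \<or> P \<in> open_triangle A B C"
proof -
  have "P = U \<or> P \<in> open_triangle U V X"
    if "0 < orient U V X" "P \<in> closed_segment (centroid U V X) U" for P U V X
    using on_median[OF that] centroid_in_open_triangle[OF that(1)] by auto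
  note * = this
  have "0 < orient B C A" "0 < orient C A B"
    "centroid B C A = centroid A B C" "centroid C A B = centroid A B C"
    "open_triangle B C A = open_triangle A B C" "open_triangle C A B = open_triangle A B C"
    using assms(1) orient_rotate[of A B C] orient_rotate[of C A B] triangle_rotate[of A B C]
      triangle_rotate[of C A B] centroid_rotate[of A B C] centroid_rotate[of C A B] by simp_all
  with *[of A B C P] *[of B C A P] *[of C A B P] assms show ?thesis
    by auto
qed

text \<open>Away from the centroid, the coordinate for the side opposite \<open>W\<close> is
  strictly the largest on the median to \<open>W\<close>, so different medians share no such
  point.\<close>

lemma medians_meet:
  assumes "0 < orient A B C" "W \<in> {A, B, C}" "W' \<in> {A, B, C}" "W \<noteq> W'"
    and "P \<in> closed_segment (centroid A B C) W" "P \<in> closed_segment (centroid A B C) W'"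
  shows "P = centroid A B C"
proof -
  have *: "0 < orient B C A" "0 < orient C A B"
    "centroid B C A = centroid A B C" "centroid C A B = centroid A B C"
    using assms(1) orient_rotate[of A B C] orient_rotate[of C A B]
      centroid_rotate[of A B C] centroid_rotate[of C A B] by simp_all
  from on_median[OF assms(1), of P] on_median[OF *(1), of P] on_median[OF *(2), of P] assms(2-)
  show ?thesis
    unfolding *(3,4) by force
qed

text \<open>In a small triangle the smallest coordinate is attained only once; on a median it is
  attained at least twice.\<close>

lemma median_avoids_small_triangles:
  assumes "0 < orient A B C" "W \<in> {A, B, C}" "P \<in> closed_segment (centroid A B C) W"
  shows "P \<notin> open_triangle A B (centroid A B C)"
    "P \<notin> open_triangle B C (centroid A B C)"
    "P \<notin> open_triangle C A (centroid A B C)"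
proof -
  have *: "0 < orient B C A" "0 < orient C A B"
    "centroid B C A = centroid A B C" "centroid C A B = centroid A B C"
    using assms(1) orient_rotate[of A B C] orient_rotate[of C A B]
      centroid_rotate[of A B C] centroid_rotate[of C A B] by simp_all
  have eq: "orient B C P = orient A B P" "orient C A P = orient A B P" if "P = centroid A B C"
    unfolding that by (simp_all only: orient_centroid)
  have "orient A B P = orient C A P \<and> orient A B P \<le> orient B C P \<or>
    orient B C P = orient A B P \<and> orient B C P \<le> orient C A P \<or>
    orient C A P = orient B C P \<and> orient C A P \<le> orient A B P"
  proof (cases "P = centroid A B C")
    case True
    then show ?thesis using eq by simp
  next
    case False
    with on_median[OF assms(1), of P] on_median[OF *(1), of P] on_median[OF *(2), of P] assms(2,3)
    show ?thesis unfolding *(3,4) by force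
  qed
  then show "P \<notin> open_triangle A B (centroid A B C)"
    "P \<notin> open_triangle B C (centroid A B C)"
    "P \<notin> open_triangle C A (centroid A B C)"
    unfolding small_triangle_iff by linarith+
qed

lemma small_triangles_disjoint:
  "open_triangle A B (centroid A B C) \<inter> open_triangle B C (centroid A B C) = {}"
  "open_triangle B C (centroid A B C) \<inter> open_triangle C A (centroid A B C) = {}"
  "open_triangle C A (centroid A B C) \<inter> open_triangle A B (centroid A B C) = {}"
  unfolding disjoint_iff small_triangle_iff by auto

lemma small_triangle_subset:
  "open_triangle A B (centroid A B C) \<subseteq> open_triangle A B C"
  "open_triangle B C (centroid A B C) \<subseteq> open_triangle A B C"
  "open_triangle C A (centroid A B C) \<subseteq> open_triangle A B C"
  unfolding subset_iff small_triangle_iff open_triangle_def[of A B C] by auto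

section \<open>Stacked triangulations and their straight-line drawings\<close>

definition star :: "'a \<Rightarrow> 'a \<Rightarrow> 'a \<Rightarrow> 'a \<Rightarrow> ('a \<times> 'a) set" where
  "star z a b c = {(z, a), (z, b), (z, c), (a, z), (b, z), (c, z)}"

text \<open>Faces are listed counterclockwise; only a part of the bounded faces has to be remembered.\<close>
inductive stacked :: "'a set \<Rightarrow> ('a \<times> 'a) set \<Rightarrow> ('a \<times> 'a \<times> 'a) set \<Rightarrow> bool" where
  base: "distinct [a, b, c] \<Longrightarrow>
    stacked {a, b, c} {(a, b), (b, a), (b, c), (c, b), (c, a), (a, c)} {(a, b, c)}"
| stack: "stacked V E F \<Longrightarrow> (a, b, c) \<in> F \<Longrightarrow> z \<notin> V \<Longrightarrow>
    F' \<subseteq> {(a, b, z), (b, c, z), (c, a, z)} \<union> (F - {(a, b, c)}) \<Longrightarrow>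
    stacked (insert z V) (star z a b c \<union> E) F'"

fun face :: "('a \<Rightarrow> complex) \<Rightarrow> 'a \<times> 'a \<times> 'a \<Rightarrow> complex set" where
  "face p (a, b, c) = open_triangle (p a) (p b) (p c)"

text \<open>The assumptions on faces are the invariant of the induction: remembered faces are
  counterclockwise, pairwise disjoint and free of vertices and edges, so a further vertex fits into
  any of them.\<close>

locale straight_drawing =
  fixes p :: "'a \<Rightarrow> complex" and V :: "'a set" and E :: "('a \<times> 'a) set"
    and F :: "('a \<times> 'a \<times> 'a) set"
  assumes inj: "inj_on p V"
    and segment_vertex: "(x, y) \<in> E \<Longrightarrow> closed_segment (p x) (p y) \<inter> p ` V \<subseteq> {p x, p y}"
    and segments_meet: "(x, y) \<in> E \<Longrightarrow> (x', y') \<in> E \<Longrightarrow> {x, y} \<noteq> {x', y'} \<Longrightarrow>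
      closed_segment (p x) (p y) \<inter> closed_segment (p x') (p y') \<subseteq> p ` ({x, y} \<inter> {x', y'})"
    and face_orient: "(a, b, c) \<in> F \<Longrightarrow> 0 < orient (p a) (p b) (p c)"
    and face_vertex: "f \<in> F \<Longrightarrow> face p f \<inter> p ` V = {}"
    and face_segment: "f \<in> F \<Longrightarrow> (x, y) \<in> E \<Longrightarrow> face p f \<inter> closed_segment (p x) (p y) = {}"
    and faces_disjoint: "f \<in> F \<Longrightarrow> g \<in> F \<Longrightarrow> f \<noteq> g \<Longrightarrow> face p f \<inter> face p g = {}"

lemma stacked_wellformed:
  assumes "stacked V E F"
  shows "finite V" "E \<subseteq> V \<times> V" "F \<subseteq> V \<times> V \<times> V" "sym E" "irrefl E"
    "\<And>a b c. (a, b, c) \<in> F \<Longrightarrow> distinct [a, b, c]"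
proof -
  have "finite V \<and> E \<subseteq> V \<times> V \<and> F \<subseteq> V \<times> V \<times> V \<and> sym E \<and> irrefl E \<and>
    (\<forall>a b c. (a, b, c) \<in> F \<longrightarrow> distinct [a, b, c])"
    using assms
  proof (induction rule: stacked.induct)
    case (base a b c)
    then show ?case
      by (auto simp: sym_def irrefl_def)
  next
    case (stack V E F a b c z F')
    then have abc: "a \<in> V" "b \<in> V" "c \<in> V" "distinct [a, b, c]" and z: "z \<notin> V"
      and EV: "E \<subseteq> V \<times> V" and FV: "F \<subseteq> V \<times> V \<times> V"
      by auto
    have "F' \<subseteq> insert z V \<times> insert z V \<times> insert z V"
      using stack.hyps(4) abc FV by auto
    moreover have "sym (star z a b c \<union> E)"
      using stack.IH by (auto simp: sym_def star_def)
    moreover have "irrefl (star z a b c \<union> E)"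
      using stack.IH abc z by (auto simp: irrefl_def star_def)
    moreover have "distinct [a', b', c']" if "(a', b', c') \<in> F'" for a' b' c'
    proof -
      from that stack.hyps(4) consider "(a', b', c') \<in> F"
        | "(a', b', c') \<in> {(a, b, z), (b, c, z), (c, a, z)}"
        by blast
      then show ?thesis
        using stack.IH abc z by cases auto
    qed
    moreover have "star z a b c \<union> E \<subseteq> insert z V \<times> insert z V"
      using EV abc by (auto simp: star_def)
    ultimately show ?case
      using stack.IH by blast
  qed
  then show "finite V" "E \<subseteq> V \<times> V" "F \<subseteq> V \<times> V \<times> V" "sym E" "irrefl E"
    "\<And>a b c. (a, b, c) \<in> F \<Longrightarrow> distinct [a, b, c]"
    by blast+
qed

lemma straight_drawing_triangle:
  assumes "distinct [a, b, c]"
  shows "\<exists>p. straight_drawing p {a, b, c} {(a, b), (b, a), (b, c), (c, b), (c, a), (a, c)} {(a, b, c)}"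
proof -
  \<comment> \<open>The points 0, 1, \<open>\<i>\<close> are in counterclockwise order, as
    \<open>face_orient\<close> demands.\<close>
  define p where "p x = (if x = a then 0 else if x = b then 1 else \<i>)" for x
  have p: "p a = 0" "p b = 1" "p c = \<i>"
    using assms by (auto simp: p_def)
  have seg: "closed_segment 0 1 = {z. Im z = 0 \<and> 0 \<le> Re z \<and> Re z \<le> 1}"
    "closed_segment 0 \<i> = {z. Re z = 0 \<and> 0 \<le> Im z \<and> Im z \<le> 1}"
    "closed_segment 1 \<i> = {z. Re z + Im z = 1 \<and> 0 \<le> Re z \<and> 0 \<le> Im z}"
    by (auto simp: closed_segment_def complex_eq_iff)
  have tri: "open_triangle 0 1 \<i> = {z. 0 < Re z \<and> 0 < Im z \<and> Re z + Im z < 1}"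
    by (auto simp: open_triangle_def orient_def)
  have "straight_drawing p {a, b, c} {(a, b), (b, a), (b, c), (c, b), (c, a), (a, c)} {(a, b, c)}"
    using assms
    by unfold_locales (auto simp: p seg tri closed_segment_commute[of 1 0] closed_segment_commute[of \<i> 0]
       closed_segment_commute[of \<i> 1] orient_def complex_eq_iff)
  then show ?thesis by blast
qed

text \<open>Except for their outer ends, the new segments lie in the open face \<open>T\<close>,
  which is free of the old drawing. Hence they touch it only at the corners \<open>a\<close>,
  \<open>b\<close>, \<open>c\<close>.\<close>

lemma (in straight_drawing) stack:
  assumes stacked: "stacked V E F" and face: "(a, b, c) \<in> F" and z: "z \<notin> V"
    and F': "F' \<subseteq> {(a, b, z), (b, c, z), (c, a, z)} \<union> (F - {(a, b, c)})"
  shows "straight_drawing (p(z := centroid (p a) (p b) (p c))) (insert z V) (star z a b c \<union> E) F'"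
proof -
  define T where "T = open_triangle (p a) (p b) (p c)"
  define Z where "Z = centroid (p a) (p b) (p c)"
  define q where "q = p(z := Z)"
  note E = stacked_wellformed(2)[OF stacked] and F = stacked_wellformed(3)[OF stacked]
  have abc: "a \<in> V" "b \<in> V" "c \<in> V" "distinct [a, b, c]"
    using F face stacked_wellformed(6)[OF stacked] by auto
  have q: "q z = Z" "\<And>x. x \<in> V \<Longrightarrow> q x = p x"
    using z by (auto simp: q_def)
  have qV: "q ` V = p ` V"
    using q(2) by (intro image_cong) auto
  have T: "0 < orient (p a) (p b) (p c)"
    and TV: "T \<inter> p ` V = {}"
    and TE: "\<And>x y. (x, y) \<in> E \<Longrightarrow> T \<inter> closed_segment (p x) (p y) = {}"
    and TF: "\<And>f. f \<in> F \<Longrightarrow> f \<noteq> (a, b, c) \<Longrightarrow> T \<inter> face p f = {}"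
    using face_orient[OF face] face_vertex[OF face] face_segment[OF face] faces_disjoint[OF face]
    by (auto simp: T_def)
  have ZT: "Z \<in> T"
    using centroid_in_open_triangle[OF T] by (simp add: Z_def T_def)
  have median: "P = p w \<or> P \<in> T" if "w \<in> {a, b, c}" "P \<in> closed_segment Z (p w)" for P w
    using median_subset[OF T _ that(2)[unfolded Z_def]] that(1) by (auto simp: T_def)
  have meet: "P = Z"
    if "w \<in> {a, b, c}" "w' \<in> {a, b, c}" "w \<noteq> w'"
      "P \<in> closed_segment Z (p w)" "P \<in> closed_segment Z (p w')" for P w w'
  proof -
    have "p w \<noteq> p w'"
      using that abc inj_onD[OF inj, of w w'] by auto
    then show ?thesis
      using medians_meet[OF T _ _ _ that(4)[unfolded Z_def] that(5)[unfolded Z_def]] that(1,2)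
      unfolding Z_def by auto
  qed

  have star_cases: "\<exists>w \<in> {a, b, c}. {x, y} = {z, w} \<and> closed_segment (q x) (q y) = closed_segment Z (p w)"
    if xy: "(x, y) \<in> star z a b c" for x y
  proof -
    obtain w where w: "w \<in> {a, b, c}" "(x, y) = (z, w) \<or> (x, y) = (w, z)"
      using xy by (auto simp: star_def)
    then have "q w = p w"
      using abc q by auto
    then have "closed_segment (q x) (q y) = closed_segment Z (p w)"
      using w(2) q(1) closed_segment_commute[of "p w" Z] by (elim disjE) simp_all
    then show ?thesis
      using w by (intro bexI[of _ w]) auto
  qed
  have old: "closed_segment (q x) (q y) = closed_segment (p x) (p y)" "x \<noteq> z" "y \<noteq> z" "x \<in> V" "y \<in> V"
    if "(x, y) \<in> E" for x y
    using that E q z by auto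
  have new_old: "closed_segment (q x) (q y) \<inter> closed_segment (q x') (q y') \<subseteq> q ` ({x, y} \<inter> {x', y'})"
    if xy: "(x, y) \<in> star z a b c" "(x', y') \<in> E" for x y x' y'
  proof
    fix P assume P: "P \<in> closed_segment (q x) (q y) \<inter> closed_segment (q x') (q y')"
    obtain w where w: "w \<in> {a, b, c}" "{x, y} = {z, w}" "P \<in> closed_segment Z (p w)"
      using star_cases[OF xy(1)] P by (metis IntD1)
    have P': "P \<in> closed_segment (p x') (p y')"
      using P old[OF xy(2)] by simp
    then have "P = p w"
      using median[OF w(1,3)] TE[OF xy(2)] by blast
    moreover have "w \<in> V"
      using w abc by auto
    ultimately have "w \<in> {x', y'}" "P = q w"
      using segment_vertex[OF xy(2)] P' q old[OF xy(2)] inj_onD[OF inj, of w] by auto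
    then show "P \<in> q ` ({x, y} \<inter> {x', y'})"
      using w by blast
  qed
  have new_new: "closed_segment (q x) (q y) \<inter> closed_segment (q x') (q y') \<subseteq> q ` ({x, y} \<inter> {x', y'})"
    if xy: "(x, y) \<in> star z a b c" "(x', y') \<in> star z a b c" "{x, y} \<noteq> {x', y'}" for x y x' y'
  proof
    fix P assume P: "P \<in> closed_segment (q x) (q y) \<inter> closed_segment (q x') (q y')"
    obtain w where w: "w \<in> {a, b, c}" "{x, y} = {z, w}" "P \<in> closed_segment Z (p w)"
      using star_cases[OF xy(1)] P by (metis IntD1)
    obtain w' where w': "w' \<in> {a, b, c}" "{x', y'} = {z, w'}" "P \<in> closed_segment Z (p w')"
      using star_cases[OF xy(2)] P by (metis IntD2)
    have "w \<noteq> w'"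
      using w w' xy(3) by auto
    then have "P = q z"
      using meet[OF w(1) w'(1) _ w(3) w'(3)] q by simp
    then show "P \<in> q ` ({x, y} \<inter> {x', y'})"
      using w w' by blast
  qed
  have new_vertex: "closed_segment (q x) (q y) \<inter> q ` insert z V \<subseteq> {q x, q y}"
    if xy: "(x, y) \<in> star z a b c" for x y
  proof
    fix P assume P: "P \<in> closed_segment (q x) (q y) \<inter> q ` insert z V"
    obtain w where w: "w \<in> {a, b, c}" "{x, y} = {z, w}" "P \<in> closed_segment Z (p w)"
      using star_cases[OF xy] P by (metis IntD1)
    have "q w = p w"
      using w(1) abc q by auto
    moreover have "P = Z \<or> P \<in> p ` V"
      using P q qV by auto
    ultimately have "P \<in> q ` {z, w}"
      using median[OF w(1,3)] TV q by auto
    then show "P \<in> {q x, q y}"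
      using w(2) by (metis image_insert image_empty)
  qed
  have small: "face q f \<subseteq> T" if "f \<in> {(a, b, z), (b, c, z), (c, a, z)}" for f
    using that abc q by (auto simp: T_def Z_def dest: small_triangle_subset[THEN subsetD])
  have small_median: "P \<notin> face q f"
    if "f \<in> {(a, b, z), (b, c, z), (c, a, z)}" "w \<in> {a, b, c}" "P \<in> closed_segment Z (p w)" for f w P
    using median_avoids_small_triangles[OF T _ that(3)[unfolded Z_def]] that(1,2) abc q
    by (auto simp: Z_def)
  have notF: "f \<notin> F" if "f \<in> {(a, b, z), (b, c, z), (c, a, z)}" for f
    using that F z by auto
  have old_face: "face q f = face p f" if "f \<in> F" for f
    using that F q by (cases f) auto
  \<comment> \<open>Each face is either an old one outside \<open>T\<close> or one of the three
    inside \<open>T\<close>; the face conditions are checked along this split.\<close>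
  have F'_cases: "f \<in> F \<and> f \<noteq> (a, b, c) \<and> face q f = face p f \<and> T \<inter> face q f = {} \<or>
      f \<in> {(a, b, z), (b, c, z), (c, a, z)} \<and> face q f \<subseteq> T" if "f \<in> F'" for f
  proof (cases "f \<in> {(a, b, z), (b, c, z), (c, a, z)}")
    case True
    then show ?thesis
      using small[OF True] by (intro disjI2 conjI)
  next
    case False
    then have "f \<in> F" "f \<noteq> (a, b, c)"
      using that F' by blast+
    then show ?thesis
      using old_face TF by simp
  qed

  have "straight_drawing q (insert z V) (star z a b c \<union> E) F'"
  proof
    have "inj_on q V" using inj q by (simp add: inj_on_def)
    moreover have "q z \<notin> q ` (V - {z})"
      using ZT TV q qV by auto
    ultimately show "inj_on q (insert z V)" by simp
  next
    fix x y assume "(x, y) \<in> star z a b c \<union> E"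
    then consider "(x, y) \<in> star z a b c" | "(x, y) \<in> E" by blast
    then show "closed_segment (q x) (q y) \<inter> q ` insert z V \<subseteq> {q x, q y}"
    proof cases
      case 1
      then show ?thesis by (rule new_vertex)
    next
      case 2
      then show ?thesis
        using segment_vertex[OF 2] old[OF 2] q qV TE[OF 2] ZT by auto
    qed
  next
    fix x y x' y'
    assume *: "(x, y) \<in> star z a b c \<union> E" "(x', y') \<in> star z a b c \<union> E" "{x, y} \<noteq> {x', y'}"
    show "closed_segment (q x) (q y) \<inter> closed_segment (q x') (q y') \<subseteq> q ` ({x, y} \<inter> {x', y'})"
    proof (cases "(x, y) \<in> E \<and> (x', y') \<in> E")
      case True
      then have "q ` ({x, y} \<inter> {x', y'}) = p ` ({x, y} \<inter> {x', y'})"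
        using old[of x y] by (intro image_cong) (auto simp: q)
      moreover have "(x, y) \<in> E" "(x', y') \<in> E"
        using True by simp_all
      ultimately show ?thesis
        using segments_meet[of x y x' y'] *(3) by (simp only: old(1) simp_thms)
    next
      case False
      then show ?thesis
        using * new_new[of x y x' y'] new_old[of x y x' y'] new_old[of x' y' x y]
        by (auto simp only: Un_iff Int_commute)
    qed
  next
    fix a' b' c' assume "(a', b', c') \<in> F'"
    with F' consider "(a', b', c') \<in> F" | "(a', b', c') \<in> {(a, b, z), (b, c, z), (c, a, z)}"
      by blast
    then show "0 < orient (q a') (q b') (q c')"
    proof cases
      case 1
      then show ?thesis using F q face_orient[OF 1] by auto
    next
      case 2
      then show ?thesis
        using abc q T by (auto simp: Z_def orient_centroid)
    qed
  next
    fix f assume f: "f \<in> F'"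
    have "face q f \<inter> p ` V = {}"
      using F'_cases[OF f] face_vertex[of f] TV by auto
    moreover have "Z \<notin> face q f"
      using F'_cases[OF f] ZT small_median[of f a Z] by auto
    ultimately show "face q f \<inter> q ` insert z V = {}"
      using q qV by auto
  next
    fix f x y assume f: "f \<in> F'" and "(x, y) \<in> star z a b c \<union> E"
    then consider "(x, y) \<in> E" | "(x, y) \<in> star z a b c" by blast
    then show "face q f \<inter> closed_segment (q x) (q y) = {}"
    proof cases
      case 1
      then show ?thesis
        using F'_cases[OF f] face_segment[of f x y] TE[OF 1] 1 unfolding old(1)[OF 1] by blast
    next
      case 2
      obtain w where w: "w \<in> {a, b, c}" "closed_segment (q x) (q y) = closed_segment Z (p w)"
        using star_cases[OF 2] by blast
      have "p w \<in> p ` V"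
        using w(1) abc by auto
      then show ?thesis
        using F'_cases[OF f] face_vertex[of f] median[OF w(1)] small_median[OF _ w(1)]
        unfolding w(2) by fastforce
    qed
  next
    fix f g assume fg: "f \<in> F'" "g \<in> F'" "f \<noteq> g"
    show "face q f \<inter> face q g = {}"
    proof (cases "f \<in> F \<or> g \<in> F")
      case True
      then show ?thesis
        using F'_cases[OF fg(1)] F'_cases[OF fg(2)] faces_disjoint[of f g] fg(3) notF by blast
    next
      case False
      then have "f \<in> {(a, b, z), (b, c, z), (c, a, z)}" "g \<in> {(a, b, z), (b, c, z), (c, a, z)}"
        using F'_cases[OF fg(1)] F'_cases[OF fg(2)] by blast+
      moreover have "face q (a, b, z) \<inter> face q (b, c, z) = {}"
        "face q (b, c, z) \<inter> face q (c, a, z) = {}" "face q (c, a, z) \<inter> face q (a, b, z) = {}"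
        using abc q by (simp_all add: Z_def small_triangles_disjoint)
      ultimately show ?thesis
        using fg(3) by blast
    qed
  qed
  then show ?thesis
    unfolding q_def Z_def .
qed

lemma stacked_straight_drawing:
  "stacked V E F \<Longrightarrow> \<exists>p. straight_drawing p V E F"
proof (induction rule: stacked.induct)
  case (base a b c)
  then show ?case by (rule straight_drawing_triangle)
next
  case (stack V E F a b c z F')
  then obtain p where p: "straight_drawing p V E F" by blast
  show ?case
    by (rule exI, rule straight_drawing.stack[OF p stack.hyps])
qed

lemma stacked_planar:
  assumes "stacked V E F"
  shows "planar \<lparr>pverts = V, parcs = E\<rparr>"
proof -
  obtain p where "straight_drawing p V E F"
    using stacked_straight_drawing[OF assms] by blast
  then interpret straight_drawing p V E F .
  have E: "x \<in> V" "y \<in> V" "x \<noteq> y" if "(x, y) \<in> E" for x y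
    using stacked_wellformed(2,5)[OF assms] that by (auto simp: irrefl_def)
  have "plane_drawing \<lparr>pverts = V, parcs = E\<rparr> p (\<lambda>x y. linepath (p x) (p y))"
    unfolding plane_drawing_def
  proof (intro conjI ballI; (clarify)?)
    show "inj_on p (pverts \<lparr>pverts = V, parcs = E\<rparr>)"
      using inj by simp
  next
    fix x y assume "(x, y) \<in> parcs \<lparr>pverts = V, parcs = E\<rparr>"
    then have xy: "(x, y) \<in> E" by simp
    then have "p x \<noteq> p y"
      using inj_onD[OF inj, of x y] E[OF xy] by blast
    moreover have "closed_segment (p x) (p y) \<inter> p ` V = {p x, p y}"
      using segment_vertex[OF xy] E[OF xy] by auto
    ultimately show "arc (linepath (p x) (p y)) \<and> pathstart (linepath (p x) (p y)) = p x \<and>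
        pathfinish (linepath (p x) (p y)) = p y \<and>
        linepath (p y) (p x) = reversepath (linepath (p x) (p y)) \<and>
        path_image (linepath (p x) (p y)) \<inter> p ` pverts \<lparr>pverts = V, parcs = E\<rparr> = {p x, p y}"
      by simp
  next
    fix x y x' y' P
    assume "(x, y) \<in> parcs \<lparr>pverts = V, parcs = E\<rparr>" "(x', y') \<in> parcs \<lparr>pverts = V, parcs = E\<rparr>"
      "{x, y} \<noteq> {x', y'}" "P \<in> path_image (linepath (p x) (p y))" "P \<in> path_image (linepath (p x') (p y'))"
    then show "P \<in> p ` ({x, y} \<inter> {x', y'})"
      using segments_meet[of x y x' y'] unfolding path_image_linepath by auto
  qed
  then show ?thesis
    unfolding planar_def by blast
qed

section \<open>3-connectedness and simplicity of stacked triangulations\<close>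

text \<open>\<open>S\<close> cannot contain all three corners of the face that receives
  \<open>z\<close>, so a surviving \<open>z\<close> is adjacent to a surviving old vertex, and the
  old vertices are connected by induction.\<close>

lemma stacked_reachable:
  assumes "stacked V E F" "S \<subseteq> V" "card S < 3" "x \<in> V - S" "y \<in> V - S"
  shows "(x, y) \<in> (E \<inter> (V - S) \<times> (V - S))\<^sup>*"
  using assms
proof (induction arbitrary: S x y rule: stacked.induct)
  case (base a b c)
  then show ?case
    by (cases "x = y") auto
next
  case (stack V E F a b c z F')
  define R where "R = E \<inter> (V - S) \<times> (V - S)"
  define R' where "R' = (star z a b c \<union> E) \<inter> (insert z V - S) \<times> (insert z V - S)"
  have "finite S"
    using stack.prems(1) stacked_wellformed(1)[OF stack.hyps(1)] finite_subset by blast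
  have EV: "E \<subseteq> V \<times> V" and abc: "a \<in> V" "b \<in> V" "c \<in> V" "distinct [a, b, c]"
    using stacked_wellformed(2,3,6)[OF stack.hyps(1)] stack.hyps(2) by auto
  have old: "(u, v) \<in> R'\<^sup>*" if "u \<in> V - S" "v \<in> V - S" for u v
  proof -
    \<comment> \<open>\<open>S\<close> may contain \<open>z\<close>, so the induction hypothesis is
      applied to \<open>S \<inter> V\<close>.\<close>
    have "card (S \<inter> V) < 3"
      using stack.prems(2) card_mono[OF \<open>finite S\<close>, of "S \<inter> V"] by simp
    moreover have "V - S \<inter> V = V - S" by blast
    ultimately have "(u, v) \<in> R\<^sup>*"
      using stack.IH[of "S \<inter> V" u v] that by (simp add: R_def)
    then show ?thesis
      using rtrancl_mono[of R R'] by (auto simp: R_def R'_def)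
  qed
  have "card {a, b, c} = 3"
    using abc by simp
  then have "\<not> {a, b, c} \<subseteq> S"
    using card_mono[OF \<open>finite S\<close>, of "{a, b, c}"] stack.prems(2) by linarith
  then obtain w where w: "w \<in> {a, b, c}" "w \<in> V - S"
    using abc by auto
  then have "(z, w) \<in> R'" "(w, z) \<in> R'" if "z \<notin> S"
    using that by (auto simp: R'_def star_def)
  then have "(z, v) \<in> R'\<^sup>*" "(v, z) \<in> R'\<^sup>*" if "z \<notin> S" "v \<in> V - S" for v
    using old[OF w(2) that(2)] old[OF that(2) w(2)] that(1)
    by (blast intro: converse_rtrancl_into_rtrancl rtrancl_into_rtrancl)+
  then have "(x, y) \<in> R'\<^sup>*"
    using stack.prems(3,4) old[of x y] by blast
  then show ?case
    by (simp add: R'_def)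
qed

lemma stacked_3_connected:
  assumes "stacked V E F" "3 < card V"
  shows "k_connected 3 \<lparr>pverts = V, parcs = E\<rparr>"
  unfolding k_connected_def
proof (intro conjI allI impI)
  show "3 < card (pverts \<lparr>pverts = V, parcs = E\<rparr>)"
    using assms(2) by simp
next
  fix S assume "S \<subseteq> pverts \<lparr>pverts = V, parcs = E\<rparr>" and card: "card S < 3"
  then have S: "S \<subseteq> V" by simp
  define H where "H = induce_subgraph (with_proj \<lparr>pverts = V, parcs = E\<rparr>) (V - S)"
  define R where "R = E \<inter> (V - S) \<times> (V - S)"
  \<comment> \<open>Connectedness is defined through the symmetric closure of the arcs; as
    \<open>E\<close> is symmetric, that closure is just \<open>R\<close>.\<close>
  have "sym E" by (rule stacked_wellformed(4)[OF assms(1)])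
  then have H: "verts H = V - S" "parcs (mk_symmetric H) = R"
    by (auto simp: H_def R_def parcs_mk_symmetric induce_subgraph_def sym_def)
  have "V - S \<noteq> {}"
    using S card assms(2) by auto
  moreover have "(x, y) \<in> rtrancl_on (V - S) R" if "x \<in> V - S" "y \<in> V - S" for x y
    using stacked_reachable[OF assms(1) S card that] that
    by (auto simp: R_def intro: rtrancl_consistent_rtrancl_on)
  ultimately have "Digraph_Component.connected H"
    by (simp add: connected_def strongly_connected_def reachable_def H)
  then show "Digraph_Component.connected (induce_subgraph (with_proj \<lparr>pverts = V, parcs = E\<rparr>)
      (pverts \<lparr>pverts = V, parcs = E\<rparr> - S))"
    by (simp add: H_def)
qed

lemma stacked_pair_graph:
  assumes "stacked V E F"
  shows "pair_graph \<lparr>pverts = V, parcs = E\<rparr>"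
proof -
  note * = stacked_wellformed[OF assms]
  have "finite E"
    using *(1,2) finite_subset by blast
  with *(1,2,4,5) show ?thesis
    by unfold_locales (auto simp: symmetric_def irrefl_def)
qed

section \<open>The graph: hubs, path and stacked pairs\<close>

text \<open>The hubs are \<open>0\<close> and \<open>1\<close>, and the path runs through the vertices \<open>5 * i + 2\<close>.
  Between \<open>x = 5 * i + 2\<close> and \<open>x' = 5 * i + 7\<close> lie a pair \<open>5 * i + 3\<close>, \<open>5 * i + 4\<close> stacked into
  the triangle \<open>x, 0, x'\<close> and a pair \<open>5 * i + 5\<close>, \<open>5 * i + 6\<close> stacked into \<open>1, x, x'\<close>.\<close>
fun strip :: "nat \<Rightarrow> (nat \<times> nat) set" where
  "strip 0 = {(0, 1), (1, 0), (1, 2), (2, 1), (2, 0), (0, 2)}"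
| "strip (Suc i) =
    star (5 * i + 6) (5 * i + 2) (5 * i + 7) (5 * i + 5) \<union>
    (star (5 * i + 5) 1 (5 * i + 2) (5 * i + 7) \<union>
    (star (5 * i + 4) (5 * i + 7) (5 * i + 2) (5 * i + 3) \<union>
    (star (5 * i + 3) (5 * i + 2) 0 (5 * i + 7) \<union>
    (star (5 * i + 7) 0 1 (5 * i + 2) \<union> strip i))))"

text \<open>The union in \<open>strip\<close> records the insertions from the inside out. The next
  path vertex goes into the face at both hubs and leaves such a face for the next round; then two
  vertices follow on each side of the path edge.\<close>

lemma stacked_strip: "stacked {..<5 * n + 3} (strip n) {(0, 1, 5 * n + 2)}"
proof (induction n)
  case 0
  have "{..<5 * 0 + 3} = {0, 1, 2::nat}" by auto
  then show ?case using stacked.base[of "0::nat" 1 2] by (simp add: numeral_2_eq_2)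
next
  case (Suc i)
  let ?x = "5 * i + 2" and ?x' = "5 * i + 7"
  have 1: "stacked (insert (5 * i + 7) {..<5 * i + 3}) (star (5 * i + 7) 0 1 (5 * i + 2) \<union> strip i)
      {(0, 1, ?x'), (1, ?x, ?x'), (?x, 0, ?x')}"
    by (rule stacked.stack[OF Suc.IH]) auto
  \<comment> \<open>Each \<open>F'\<close> keeps just the faces that receive a later vertex.\<close>
  note 2 = stacked.stack[OF 1, where F' = "{(0, 1, ?x'), (1, ?x, ?x'), (?x', ?x, 5 * i + 3)}",
      of ?x 0 ?x' "5 * i + 3", simplified]
  note 3 = stacked.stack[OF 2, where F' = "{(0, 1, ?x'), (1, ?x, ?x')}",
      of ?x' ?x "5 * i + 3" "5 * i + 4", simplified]
  note 4 = stacked.stack[OF 3, where F' = "{(0, 1, ?x'), (?x, ?x', 5 * i + 5)}",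
      of 1 ?x ?x' "5 * i + 5", simplified]
  note 5 = stacked.stack[OF 4, where F' = "{(0, 1, ?x')}",
      of ?x ?x' "5 * i + 5" "5 * i + 6", simplified]
  have *: "{..<5 * Suc i + 3} = insert (5 * i + 6) (insert (5 * i + 5) (insert (5 * i + 4)
      (insert (5 * i + 3) (insert (5 * i + 7) {..<5 * i + 3}))))"
    "5 * Suc i + 2 = 5 * i + 7"
    by auto
  show ?case
    unfolding * using 5 by simp
qed

lemma strip_mono:
  assumes "i < n"
  shows "strip (Suc i) \<subseteq> strip n"
  using assms
proof (induction n)
  case (Suc n)
  then show ?case
    by (cases "i = n") (auto simp del: strip.simps, auto)
qed simp

lemma strip_hubs: "i \<le> n \<Longrightarrow> (0, 5 * i + 2) \<in> strip n \<and> (1, 5 * i + 2) \<in> strip n"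
  by (induction n) (auto simp: star_def le_Suc_eq)

text \<open>These vertices occur only in the stars of their own round, so their degrees stay at most
  4 and 3 however long the strip grows.\<close>

lemma strip_neighbours:
  "(5 * i + 3, v) \<in> strip n \<Longrightarrow> v \<in> {5 * i + 2, 0, 5 * i + 7, 5 * i + 4}"
  "(5 * i + 4, v) \<in> strip n \<Longrightarrow> v \<in> {5 * i + 7, 5 * i + 2, 5 * i + 3}"
  "(5 * i + 5, v) \<in> strip n \<Longrightarrow> v \<in> {1, 5 * i + 2, 5 * i + 7, 5 * i + 6}"
  "(5 * i + 6, v) \<in> strip n \<Longrightarrow> v \<in> {5 * i + 2, 5 * i + 7, 5 * i + 5}"
  by (induction n; auto simp: star_def; presburger)+

section \<open>Colour lists and the blocks that defeat the hub colours\<close>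

text \<open>These are the sets P, and \<open>lower\<close> gives the sets Q. They are chosen so that
  a colour c is ruled out at path vertex \<open>m + 1\<close> once every colour still possible at
  vertex \<open>m\<close> lies together with c in \<open>upper m\<close> or in
  \<open>lower m\<close>. Index 5 serves the gap between two blocks, where it provides lists of the
  required size.\<close>

definition upper :: "nat \<Rightarrow> nat set" where
  "upper m = [{1, 2, 3}, {1, 2, 4}, {3, 4, 5}, {1, 2, 3}, {1, 2, 5}, {1, 2, 3}] ! m"

definition lower :: "nat \<Rightarrow> nat set" where
  "lower m = [{3, 4, 5}, {1, 2, 5}, {3, 4, 5}, {1, 2, 4}, {3, 4, 5}, {1, 2, 3}] ! m"

lemma upper_lower:
  assumes "m < 6"
  shows "card (upper m) = 3" "upper m \<subseteq> {1..5}" "card (lower m) = 3" "lower m \<subseteq> {1..5}"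
proof -
  have "m \<in> {0, 1, 2, 3, 4, 5}" using assms by auto
  then show "card (upper m) = 3" "upper m \<subseteq> {1..5}" "card (lower m) = 3" "lower m \<subseteq> {1..5}"
    by (auto simp: upper_def lower_def)
qed

text \<open>The possible values of \<open>f 0\<close>, \<dots>, \<open>f 5\<close> shrink from five to none, one at a time.\<close>
lemma no_path_colouring:
  fixes f :: "nat \<Rightarrow> nat"
  assumes range: "\<And>j. j \<le> 5 \<Longrightarrow> f j \<in> {1..5}"
    and step: "\<And>j. j < 5 \<Longrightarrow> f j \<noteq> f (Suc j)"
      "\<And>j. j < 5 \<Longrightarrow> \<not> {f j, f (Suc j)} \<subseteq> upper j"
      "\<And>j. j < 5 \<Longrightarrow> \<not> {f j, f (Suc j)} \<subseteq> lower j"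
  shows False
proof -
  have range: "f j \<in> {1, 2, 3, 4, 5}" if "j \<le> 5" for j
    using range[OF that] by auto
  have "f 1 \<in> {1, 2, 4, 5}"
    using range[of 0] range[of 1] step[of 0] by (auto simp: upper_def lower_def)
  then have "f 2 \<in> {3, 4, 5}"
    using range[of 2] step[of 1] by (auto simp: upper_def lower_def eval_nat_numeral)
  then have "f 3 \<in> {1, 2}"
    using range[of 3] step[of 2] by (auto simp: upper_def lower_def eval_nat_numeral)
  then have "f 4 = 5"
    using range[of 4] step[of 3] by (auto simp: upper_def lower_def eval_nat_numeral)
  then show False
    using range[of 5] step[of 4] by (auto simp: upper_def lower_def eval_nat_numeral)
qed

text \<open>Block \<open>k\<close> consists of the vertices \<open>5 * i + 2\<close>, \<dots>, \<open>5 * i + 6\<close> with \<open>i div 6 = k\<close>; it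
  rules out that the hubs have the colours \<open>10 + k div 7\<close> and \<open>20 + k mod 7\<close>.\<close>
definition colour_lists :: "nat \<Rightarrow> nat set" where
  "colour_lists w =
    (let i = (w - 2) div 5; r = (w - 2) mod 5; k = i div 6; a = 10 + k div 7; b = 20 + k mod 7 in
     if w = 0 then {10..<17} else if w = 1 then {20..<27}
     else if r = 0 then {a, b} \<union> {1..5}
     else if r = 1 then insert a (upper (i mod 6)) else if r = 2 then upper (i mod 6)
     else if r = 3 then insert b (lower (i mod 6)) else lower (i mod 6))"

lemma colour_lists_simps:
  "colour_lists 0 = {10..<17}" "colour_lists (Suc 0) = {20..<27}"
  "colour_lists (5 * i + 2) = {10 + i div 6 div 7, 20 + i div 6 mod 7} \<union> {1..5}"
  "colour_lists (5 * i + 3) = insert (10 + i div 6 div 7) (upper (i mod 6))"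
  "colour_lists (5 * i + 4) = upper (i mod 6)"
  "colour_lists (5 * i + 5) = insert (20 + i div 6 mod 7) (lower (i mod 6))"
  "colour_lists (5 * i + 6) = lower (i mod 6)"
proof -
  have "(5 * i + r) div 5 = i" "(5 * i + r) mod 5 = r" if "r < 5" for r
    using that by simp_all
  note * = this[of 0, simplified] this[of 1, simplified] this[of 2, simplified] this[of 3, simplified]
    this[of 4, simplified]
  have "5 * i + 3 - 2 = 5 * i + 1" "5 * i + 4 - 2 = 5 * i + 2" "5 * i + 5 - 2 = 5 * i + 3"
    "5 * i + 6 - 2 = 5 * i + 4"
    by simp_all
  note * = this *
  show "colour_lists 0 = {10..<17}" "colour_lists (Suc 0) = {20..<27}"
    "colour_lists (5 * i + 2) = {10 + i div 6 div 7, 20 + i div 6 mod 7} \<union> {1..5}"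
    "colour_lists (5 * i + 3) = insert (10 + i div 6 div 7) (upper (i mod 6))"
    "colour_lists (5 * i + 4) = upper (i mod 6)"
    "colour_lists (5 * i + 5) = insert (20 + i div 6 mod 7) (lower (i mod 6))"
    "colour_lists (5 * i + 6) = lower (i mod 6)"
    by (simp_all add: colour_lists_def Let_def *)
qed

text \<open>A path with 293 gaps has 294 = 49 * 6 vertices, one block of six for each pair of hub
  colours. Hubs and path vertices have seven colours; in the gaps the list sizes match the degree
  bounds 4 and 3.\<close>

lemma strip_lists_large:
  assumes "w < 5 * 293 + 3"
  shows "min 7 (out_degree (with_proj \<lparr>pverts = V, parcs = strip n\<rparr>) w) \<le> card (colour_lists w)"
proof -
  let ?d = "out_degree (with_proj \<lparr>pverts = V, parcs = strip n\<rparr>)"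
  have deg: "?d w \<le> card X" if "\<And>v. (w, v) \<in> strip n \<Longrightarrow> v \<in> X" "finite X" for w X
  proof -
    have "out_arcs (with_proj \<lparr>pverts = V, parcs = strip n\<rparr>) w \<subseteq> Pair w ` X"
      using that(1) by (auto simp: out_arcs_def)
    then have "?d w \<le> card (Pair w ` X)"
      unfolding out_degree_def using that(2) by (intro card_mono) auto
    also have "\<dots> \<le> card X"
      by (rule card_image_le[OF that(2)])
    finally show ?thesis .
  qed
  consider "w = 0" | "w = Suc 0" | i where "w = 5 * i + 2" | i where "w = 5 * i + 3"
    | i where "w = 5 * i + 4" | i where "w = 5 * i + 5" | i where "w = 5 * i + 6"
  proof -
    assume a: "w = 0 \<Longrightarrow> thesis" "w = Suc 0 \<Longrightarrow> thesis" "\<And>i. w = 5 * i + 2 \<Longrightarrow> thesis"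
      "\<And>i. w = 5 * i + 3 \<Longrightarrow> thesis" "\<And>i. w = 5 * i + 4 \<Longrightarrow> thesis" "\<And>i. w = 5 * i + 5 \<Longrightarrow> thesis"
      "\<And>i. w = 5 * i + 6 \<Longrightarrow> thesis"
    have "w = 0 \<or> w = Suc 0 \<or> (\<exists>i. w = 5 * i + 2 \<or> w = 5 * i + 3 \<or> w = 5 * i + 4 \<or>
        w = 5 * i + 5 \<or> w = 5 * i + 6)"
      by presburger
    then show thesis using a by blast
  qed
  then show ?thesis
  proof cases
    case (3 i)
    then have "i < 7 * 7 * 6"
      using assms by simp
    \<comment> \<open>This keeps the first hub colour below 17, hence different from the second one,
      which is at least 20.\<close>
    then have "i div 6 div 7 < 7"
      by (simp add: div_less_iff_less_mult)
    then have "card (colour_lists w) = 7"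
      unfolding 3 colour_lists_simps by simp
    then show ?thesis by simp
  next
    case (4 i)
    have "10 + i div 6 div 7 \<notin> upper (i mod 6)" "finite (upper (i mod 6))"
      using upper_lower(2)[of "i mod 6"] by (auto intro: finite_subset)
    then have "card (colour_lists w) = 4"
      unfolding 4 colour_lists_simps using upper_lower(1)[of "i mod 6"] by simp
    moreover have "?d w \<le> 4"
      using deg[of w "{5 * i + 2, 0, 5 * i + 7, 5 * i + 4}"] strip_neighbours(1)[of i _ n] unfolding 4 by simp
    ultimately show ?thesis by simp
  next
    case (5 i)
    have "card (colour_lists w) = 3"
      unfolding 5 colour_lists_simps using upper_lower(1)[of "i mod 6"] by simp
    moreover have "?d w \<le> 3"
      using deg[of w "{5 * i + 7, 5 * i + 2, 5 * i + 3}"] strip_neighbours(2)[of i _ n] unfolding 5 by simp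
    ultimately show ?thesis by simp
  next
    case (6 i)
    have "20 + i div 6 mod 7 \<notin> lower (i mod 6)" "finite (lower (i mod 6))"
      using upper_lower(4)[of "i mod 6"] by (auto intro: finite_subset)
    then have "card (colour_lists w) = 4"
      unfolding 6 colour_lists_simps using upper_lower(3)[of "i mod 6"] by simp
    moreover have "?d w \<le> 4"
      using deg[of w "{1, 5 * i + 2, 5 * i + 7, 5 * i + 6}"] strip_neighbours(3)[of i _ n] unfolding 6 by simp
    ultimately show ?thesis by simp
  next
    case (7 i)
    have "card (colour_lists w) = 3"
      unfolding 7 colour_lists_simps using upper_lower(3)[of "i mod 6"] by simp
    moreover have "?d w \<le> 3"
      using deg[of w "{5 * i + 2, 5 * i + 7, 5 * i + 5}"] strip_neighbours(4)[of i _ n] unfolding 7 by simp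
    ultimately show ?thesis by simp
  qed (simp_all add: colour_lists_simps)
qed

text \<open>Meant for the complete graph on two consecutive path vertices and the two vertices
  stacked on one side of them: their colours cannot all lie in one set of size 3.\<close>

lemma card_3_no_4_distinct:
  assumes "card P = 3" "{p, q, r, s} \<subseteq> P"
  shows "\<not> distinct [p, q, r, s]"
proof
  assume "distinct [p, q, r, s]"
  then have "card {p, q, r, s} = 4" by simp
  moreover have "finite P"
    using assms(1) card.infinite by fastforce
  ultimately show False
    using card_mono[OF _ assms(2)] assms(1) by simp
qed

text \<open>The colours of the hubs select a block, and the colouring restricted to its six path
  vertices contradicts \<open>no_path_colouring\<close>.\<close>

lemma strip_not_colourable:
  "\<not> list_colourable \<lparr>pverts = {..<5 * 293 + 3}, parcs = strip 293\<rparr> colour_lists"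
proof
  assume "list_colourable \<lparr>pverts = {..<5 * 293 + 3}, parcs = strip 293\<rparr> colour_lists"
  then obtain \<phi> where L: "\<And>w. w < 5 * 293 + 3 \<Longrightarrow> \<phi> w \<in> colour_lists w"
    and proper: "\<And>v w. (v, w) \<in> strip 293 \<Longrightarrow> \<phi> v \<noteq> \<phi> w"
    unfolding list_colourable_def list_colouring_def by fastforce
  have "\<phi> 0 \<in> {10..<17}" "\<phi> 1 \<in> {20..<27}"
    using L[of 0] L[of 1] by (simp_all add: colour_lists_simps)
  then obtain c d where cd: "\<phi> 0 = 10 + c" "c < 7" "\<phi> 1 = 20 + d" "d < 7"
    by (auto simp: le_iff_add)
  \<comment> \<open>\<open>k div 7\<close> and \<open>k mod 7\<close> recover \<open>c\<close> and
    \<open>d\<close>, so block \<open>k\<close> is the one made for this pair of hub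
    colours.\<close>
  define k where "k = 7 * c + d"
  define f where "f j = \<phi> (5 * (6 * k + j) + 2)" for j
  have k: "k < 49" "10 + k div 7 = \<phi> 0" "20 + k mod 7 = \<phi> 1"
    using cd by (simp_all add: k_def)
  have block: "(6 * k + j) div 6 = k" "(6 * k + j) mod 6 = j" if "j < 6" for j
    using that by simp_all
  have star: "star (5 * i + 6) (5 * i + 2) (5 * i + 7) (5 * i + 5) \<subseteq> strip 293"
    "star (5 * i + 5) 1 (5 * i + 2) (5 * i + 7) \<subseteq> strip 293"
    "star (5 * i + 4) (5 * i + 7) (5 * i + 2) (5 * i + 3) \<subseteq> strip 293"
    "star (5 * i + 3) (5 * i + 2) 0 (5 * i + 7) \<subseteq> strip 293"
    "star (5 * i + 7) 0 1 (5 * i + 2) \<subseteq> strip 293" if "i < 293" for i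
    using strip_mono[OF that] by auto
  show False
  proof (rule no_path_colouring[of f])
    fix j :: nat assume j: "j \<le> 5"
    \<comment> \<open>The largest index is 6 * 48 + 5 = 293, the last path vertex, which
      \<open>strip_hubs\<close> still covers.\<close>
    have "(0, 5 * (6 * k + j) + 2) \<in> strip 293 \<and> (1, 5 * (6 * k + j) + 2) \<in> strip 293"
      using j k by (intro strip_hubs) simp
    then have "f j \<noteq> \<phi> 0" "f j \<noteq> \<phi> 1"
      using proper unfolding f_def by metis+
    moreover have "f j \<in> colour_lists (5 * (6 * k + j) + 2)"
      unfolding f_def using j k by (intro L) simp
    ultimately show "f j \<in> {1..5}"
      unfolding colour_lists_simps using j k block[of j] by auto
  next
    fix j :: nat assume j: "j < 5"
    define i where "i = 6 * k + j"
    have i: "i < 293" "i div 6 = k" "i mod 6 = j" "5 * (6 * k + Suc j) + 2 = 5 * i + 7"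
      using j k block[of j] by (auto simp: i_def)
    have f: "f j = \<phi> (5 * i + 2)" "f (Suc j) = \<phi> (5 * i + 7)"
      unfolding f_def i by (simp_all add: i_def)
    show "f j \<noteq> f (Suc j)"
      using star(5)[OF i(1)] proper[of "5 * i + 7" "5 * i + 2"] unfolding f by (auto simp: star_def)
    have adj: "distinct [\<phi> (5 * i + 2), \<phi> (5 * i + 7), \<phi> (5 * i + 3), \<phi> (5 * i + 4)]"
      "distinct [\<phi> (5 * i + 2), \<phi> (5 * i + 7), \<phi> (5 * i + 5), \<phi> (5 * i + 6)]"
      "\<phi> (5 * i + 3) \<noteq> \<phi> 0" "\<phi> (5 * i + 5) \<noteq> \<phi> 1"
      using star[OF i(1)] by (auto simp: star_def dest: proper)
    have "\<phi> (5 * i + 3) \<in> insert (\<phi> 0) (upper j)" "\<phi> (5 * i + 4) \<in> upper j"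
      "\<phi> (5 * i + 5) \<in> insert (\<phi> 1) (lower j)" "\<phi> (5 * i + 6) \<in> lower j"
      using L[of "5 * i + 3"] L[of "5 * i + 4"] L[of "5 * i + 5"] L[of "5 * i + 6"] i
      unfolding colour_lists_simps i k by simp_all
    \<comment> \<open>The vertices of degree at most 4 are adjacent to a hub that already has their
      extra colour, which leaves them only the three colours of \<open>upper j\<close> or
      \<open>lower j\<close>.\<close>
    then have *: "\<phi> (5 * i + 3) \<in> upper j" "\<phi> (5 * i + 4) \<in> upper j"
      "\<phi> (5 * i + 5) \<in> lower j" "\<phi> (5 * i + 6) \<in> lower j"
      using adj(3,4) by simp_all
    have card: "card (upper j) = 3" "card (lower j) = 3"
      using j by (simp_all add: upper_lower)
    show "\<not> {f j, f (Suc j)} \<subseteq> upper j"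
      using card_3_no_4_distinct[OF card(1)] adj(1) *(1,2) unfolding f by blast
    show "\<not> {f j, f (Suc j)} \<subseteq> lower j"
      using card_3_no_4_distinct[OF card(2)] adj(2) *(3,4) unfolding f by blast
  qed
qed

theorem theorem6:
  shows "\<exists>G :: nat pair_pre_digraph.
    pair_graph G \<and>
    k_connected 3 G \<and>
    \<not> complete_digraph (card (pverts G)) (with_proj G) \<and>
    planar G \<and>
    \<not> degree_truncated_choosable 7 G"
proof (intro exI conjI)
  let ?G = "\<lparr>pverts = {..<5 * 293 + 3}, parcs = strip 293\<rparr>"
  note stacked = stacked_strip[of 293]
  show "pair_graph ?G"
    by (rule stacked_pair_graph[OF stacked])
  show "k_connected 3 ?G"
    by (rule stacked_3_connected[OF stacked]) simp
  show "planar ?G"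
    by (rule stacked_planar[OF stacked])
  \<comment> \<open>Vertex 4 is the inner stacked vertex of the first gap and is separated from hub
    0 by vertex 3; this one missing arc refutes completeness.\<close>
  have "(4, 0) \<notin> strip 293"
    using strip_neighbours(2)[of 0 0 293] by auto
  then show "\<not> complete_digraph (card (pverts ?G)) (with_proj ?G)"
    by (auto simp: complete_digraph_def)
  show "\<not> degree_truncated_choosable 7 ?G"
    unfolding degree_truncated_choosable_def
    using strip_lists_large strip_not_colourable by auto
qed

end
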